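(* If $M\in\mathcal L\cap\mathcal G$ is exponentially stable, then there exists $\epsilon>0$ such that $\widetilde M$ is exponentially stable for every $\widetilde M\in\mathcal L\cap\mathcal G$ with $\operatorname{Var}(M-\widetilde M)<\epsilon$.
   Context: Fix an integer $d\ge 1$ and a norm $|\cdot|$ on $\mathbb R^d$; $\|\cdot\|$ is the induced matrix norm on the space $\mathcal M_d(\mathbb R)$ of real $d\times d$ matrices, $\mathrm{Id}$ is the identity matrix, $\|\cdot\|_\infty$ the supremum norm. For $M:[-1,0]\to\mathcal M_d(\mathbb R)$, the total variation $\operatorname{Var}(M)$ is the supremum of $\sum_{i=1}^k\|M(t_{i+1})-M(t_i)\|$ over all $k\in\mathbb N$ and $-1=t_1<\dots<t_{k+1}=0$. $\mathrm{NBV}([-1,0],\mathcal M_d(\mathbb R))$ is the set of functions $M:[-1,0]\to\mathcal M_d(\mathbb R)$ with $\operatorname{Var}(M)<+\infty$, $M(-1)=0$ and $M$ right-continuous on $(-1,0)$. Such $M$ correspond one-to-one to matrix-valued Borel measures $\mu_M$ on $[-1,0]$ (each entry a finite signed measure) via $M(t)=\mu_M([-1,t])$ for $t\in(-1,0]$. Integrals $\int_{-1}^0\cdots dM(\theta)$ are integrals over $[-1,0]$ with respect to $\mu_M$. System $\Sigma_M$: $x(t)=\int_{-1}^0 dM(\theta)\,x(t+\theta)$, $t\ge 0$. Solutions are continuous functions $x:[-1,+\infty)\to\mathbb R^d$ satisfying this for all $t\ge0$; write $x_t(\theta)=x(t+\theta)$, $\theta\in[-1,0]$; $x_0$ is the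 initial condition. Let $\mathcal C_0=\{\eta\in \mathcal C([-1,0],\mathbb R^d):\eta(0)=\int_{-1}^0 dM(\theta)\eta(\theta)\}$. Let $\mathcal W$ be the set of $M\in \mathrm{NBV}([-1,0],\mathcal M_d(\mathbb R))$ with $\det(\mathrm{Id}-(M(0)-M(0^-)))\ne0$; for $M\in\mathcal W$, every $\phi\in\mathcal C_0$ is the initial condition of a unique solution on $[-1,+\infty)$. Exponential rate, for $M\in\mathcal W$: $\omega_M$ is the infimum (in $[-\infty,+\infty)$) of the $\alpha\in\mathbb R$ for which there is $K>0$ such that for all $\phi\in\mathcal C_0$ the solution $x$ with $x_0=\phi$ satisfies $\|x_t\|_\infty\le Ke^{\alpha t}\|\phi\|_\infty$ for all $t\ge0$. $M$ is exponentially stable if $\omega_M<0$. Characteristic function: $\Delta_M(s)=\det\left(\mathrm{Id}-\int_{-1}^0 e^{s\theta}dM(\theta)\right)$, $s\in\mathbb C$. Spectral abscissa: $S_M=\sup\{\operatorname{Re}s:\Delta_M(s)=0\}$ ($=-\infty$ if there are no zeros). $\mathcal G=\{M\in\mathcal W: S_M=\omega_M\}$, and $\mathcal L$ is the set of $M\in\mathrm{NBV}([-1,0],\mathcal M_d(\mathbb R))$ such that $S_M<+\infty$ and $\inf_{\operatorname{Re}s\ge\alpha}|\Delta_M(s)|>0$ for every real $\alpha>S_M$. *)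

theory Defs
  imports "HOL-Probability.Distribution_Functions"
begin

section \<open>Norms and total variation\<close>

definition is_norm :: "('a::real_vector \<Rightarrow> real) \<Rightarrow> bool" where
  "is_norm N \<longleftrightarrow>
     (\<forall>x. 0 \<le> N x) \<and> (\<forall>x. N x = 0 \<longleftrightarrow> x = 0) \<and>
     (\<forall>c x. N (c *\<^sub>R x) = \<bar>c\<bar> * N x) \<and> (\<forall>x y. N (x + y) \<le> N x + N y)"

definition matrix_norm :: "(real ^ 'n \<Rightarrow> real) \<Rightarrow> real ^ 'n ^ 'n \<Rightarrow> real" where
  "matrix_norm N A = (SUP v\<in>{v. N v = 1}. N (A *v v))"

definition sup_norm :: "('a \<Rightarrow> real) \<Rightarrow> (real \<Rightarrow> 'a) \<Rightarrow> real" where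
  "sup_norm N \<eta> = (SUP \<theta>\<in>{-1..0}. N (\<eta> \<theta>))"

text \<open>Functions on \<open>[-1,0]\<close> are represented by functions on the whole real line of which only
  the values on \<open>[-1,0]\<close> are ever inspected. The total variation is relative to a given
  norm \<open>nrm\<close> on the codomain.\<close>

definition variation :: "('a::minus \<Rightarrow> real) \<Rightarrow> (real \<Rightarrow> 'a) \<Rightarrow> ereal" where
  "variation nrm f = Sup {ereal (\<Sum>i=1..k. nrm (f (t (i + 1)) - f (t i))) | (k::nat) (t :: nat \<Rightarrow> real).
     t 1 = -1 \<and> t (k + 1) = 0 \<and> (\<forall>i\<in>{1..k}. t i < t (i + 1))}"

abbreviation Var :: "(real ^ 'n \<Rightarrow> real) \<Rightarrow> (real \<Rightarrow> real ^ 'n ^ 'n) \<Rightarrow> ereal" where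
  "Var N \<equiv> variation (matrix_norm N)"

definition NBV :: "(real ^ 'n \<Rightarrow> real) \<Rightarrow> (real \<Rightarrow> real ^ 'n ^ 'n) set" where
  "NBV N = {M. Var N M < \<infinity> \<and> M (-1) = 0 \<and> (\<forall>t\<in>{-1<..<0}. continuous (at_right t) M)}"


section \<open>Integration against a function of bounded variation\<close>

text \<open>The finite signed Borel measure \<open>\<mu>\<close> on \<open>[-1,0]\<close> with \<open>\<mu> [-1,t] = g t\<close> for
  \<open>-1 < t \<le> 0\<close> is encoded as a difference \<open>P - Q\<close> of finite positive measures. These live on the
  whole line, but only their restrictions to \<open>[-1,0]\<close> are used. Nothing is required at \<open>t = -1\<close>,
  so \<open>\<mu>\<close> has the atom \<open>g(-1+)\<close> at \<open>-1\<close>. For every entry of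
  \<open>M \<in> NBV N\<close> such a pair exists (\<open>NBV_entry_represents\<close> below), and for continuous \<open>f\<close> the
  integral does not depend on its choice (\<open>stieltjes_integral_eq\<close> below).\<close>

definition represents :: "(real \<Rightarrow> real) \<Rightarrow> real measure \<Rightarrow> real measure \<Rightarrow> bool" where
  "represents g P Q \<longleftrightarrow> finite_borel_measure P \<and> finite_borel_measure Q \<and>
     (\<forall>t\<in>{-1<..0}. g t = measure P {-1..t} - measure Q {-1..t})"

definition stieltjes_integral ::
    "(real \<Rightarrow> real) \<Rightarrow> (real \<Rightarrow> 'b::{banach,second_countable_topology}) \<Rightarrow> 'b" where
  "stieltjes_integral g f =
     (let (P, Q) = (SOME (P, Q). represents g P Q)
      in (LINT \<theta>:{-1..0}|P. f \<theta>) - (LINT \<theta>:{-1..0}|Q. f \<theta>))"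

text \<open>\<open>\<integral> dM(\<theta>) \<eta>(\<theta>)\<close> and \<open>\<integral> e\<^sup>s\<^sup>\<theta> dM(\<theta>)\<close>, with respect to the matrix-valued measure of \<open>M\<close>.\<close>

definition integral_vec :: "(real \<Rightarrow> real ^ 'n ^ 'n) \<Rightarrow> (real \<Rightarrow> real ^ 'n) \<Rightarrow> real ^ 'n" where
  "integral_vec M \<eta> =
     (\<chi> i. \<Sum>j\<in>UNIV. stieltjes_integral (\<lambda>\<theta>. M \<theta> $ i $ j) (\<lambda>\<theta>. \<eta> \<theta> $ j))"

definition integral_exp :: "(real \<Rightarrow> real ^ 'n ^ 'n) \<Rightarrow> complex \<Rightarrow> complex ^ 'n ^ 'n" where
  "integral_exp M s =
     (\<chi> i j. stieltjes_integral (\<lambda>\<theta>. M \<theta> $ i $ j) (\<lambda>\<theta>. exp (s * complex_of_real \<theta>)))"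


section \<open>The difference equation and its stability\<close>

definition solution :: "(real \<Rightarrow> real ^ 'n ^ 'n) \<Rightarrow> (real \<Rightarrow> real ^ 'n) \<Rightarrow> bool" where
  "solution M x \<longleftrightarrow>
     continuous_on {-1..} x \<and> (\<forall>t\<ge>0. x t = integral_vec M (\<lambda>\<theta>. x (t + \<theta>)))"

definition C0 :: "(real \<Rightarrow> real ^ 'n ^ 'n) \<Rightarrow> (real \<Rightarrow> real ^ 'n) set" where
  "C0 M = {\<eta>. continuous_on {-1..0} \<eta> \<and> \<eta> 0 = integral_vec M \<eta>}"

definition W :: "(real ^ 'n \<Rightarrow> real) \<Rightarrow> (real \<Rightarrow> real ^ 'n ^ 'n) set" where
  "W N = {M \<in> NBV N. det (mat 1 - (M 0 - Lim (at_left 0) M)) \<noteq> 0}"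

text \<open>For \<open>M \<in> W N\<close> every \<open>\<phi> \<in> C0 M\<close> is the initial condition of exactly one solution (on
  \<open>[-1,\<infinity>)\<close>), so the universal quantifier over \<open>x\<close> refers to that solution.\<close>

definition exp_rate :: "(real ^ 'n \<Rightarrow> real) \<Rightarrow> (real \<Rightarrow> real ^ 'n ^ 'n) \<Rightarrow> ereal" where
  "exp_rate N M = Inf (ereal ` {\<alpha>. \<exists>K>0. \<forall>\<phi>\<in>C0 M. \<forall>x.
     solution M x \<and> (\<forall>\<theta>\<in>{-1..0}. x \<theta> = \<phi> \<theta>) \<longrightarrow>
       (\<forall>t\<ge>0. sup_norm N (\<lambda>\<theta>. x (t + \<theta>)) \<le> K * exp (\<alpha> * t) * sup_norm N \<phi>)})"

definition exponentially_stable :: "(real ^ 'n \<Rightarrow> real) \<Rightarrow> (real \<Rightarrow> real ^ 'n ^ 'n) \<Rightarrow> bool" where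
  "exponentially_stable N M \<longleftrightarrow> exp_rate N M < 0"

definition char_fun :: "(real \<Rightarrow> real ^ 'n ^ 'n) \<Rightarrow> complex \<Rightarrow> complex" where
  "char_fun M s = det (mat 1 - integral_exp M s)"

definition spectral_abscissa :: "(real \<Rightarrow> real ^ 'n ^ 'n) \<Rightarrow> ereal" where
  "spectral_abscissa M = Sup {ereal (Re s) | s. char_fun M s = 0}"

definition G :: "(real ^ 'n \<Rightarrow> real) \<Rightarrow> (real \<Rightarrow> real ^ 'n ^ 'n) set" where
  "G N = {M \<in> W N. spectral_abscissa M = exp_rate N M}"

definition L :: "(real ^ 'n \<Rightarrow> real) \<Rightarrow> (real \<Rightarrow> real ^ 'n ^ 'n) set" where
  "L N = {M \<in> NBV N. spectral_abscissa M < \<infinity> \<and>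
     (\<forall>\<alpha>::real. spectral_abscissa M < ereal \<alpha> \<longrightarrow>
        (INF s\<in>{s. \<alpha> \<le> Re s}. cmod (char_fun M s)) > 0)}"


section \<open>Well-definedness of the integral\<close>

lemma sum_of_restricted_measures:
  assumes "finite_borel_measure P" "finite_borel_measure Q"
  obtains R where "finite_borel_measure R"
    "\<And>A. A \<in> sets borel \<Longrightarrow> measure R A = measure P ({-1..0} \<inter> A) + measure Q ({-1..0} \<inter> A)"
proof -
  interpret P: finite_borel_measure P by fact
  interpret Q: finite_borel_measure Q by fact
  let ?I = "{-1..0::real}"
  define R where "R = measure_of UNIV (sets borel) (\<lambda>A. emeasure P (?I \<inter> A) + emeasure Q (?I \<inter> A))"
  have R: "emeasure R A = emeasure P (?I \<inter> A) + emeasure Q (?I \<inter> A)" if "A \<in> sets borel" for A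
    unfolding R_def
  proof (rule emeasure_measure_of_sigma[OF _ _ _ that])
    show "sigma_algebra UNIV (sets (borel :: real measure))"
      using sets.sigma_algebra_axioms[of "borel :: real measure"] by simp
    show "positive (sets borel) (\<lambda>A. emeasure P (?I \<inter> A) + emeasure Q (?I \<inter> A))"
      by (simp add: positive_def)
    show "countably_additive (sets borel) (\<lambda>A. emeasure P (?I \<inter> A) + emeasure Q (?I \<inter> A))"
    proof (rule countably_additiveI)
      fix A :: "nat \<Rightarrow> real set"
      assume A: "range A \<subseteq> sets borel" "disjoint_family A"
      have *: "disjoint_family (\<lambda>i. ?I \<inter> A i)" using A(2) by (auto simp: disjoint_family_on_def)
      have B: "?I \<inter> A i \<in> sets borel" for i using A(1) by auto
      have "(\<Sum>i. emeasure P (?I \<inter> A i)) = emeasure P (\<Union>i. ?I \<inter> A i)"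
        using * B P.M_is_borel by (intro suminf_emeasure) auto
      moreover have "(\<Sum>i. emeasure Q (?I \<inter> A i)) = emeasure Q (\<Union>i. ?I \<inter> A i)"
        using * B Q.M_is_borel by (intro suminf_emeasure) auto
      ultimately show "(\<Sum>i. emeasure P (?I \<inter> A i) + emeasure Q (?I \<inter> A i)) =
          emeasure P (?I \<inter> \<Union> (range A)) + emeasure Q (?I \<inter> \<Union> (range A))"
        by (simp only: suminf_add[OF summableI summableI, symmetric] Int_UN_distrib)
    qed
  qed
  have sets: "sets R = sets borel"
    unfolding R_def using sets.sets_measure_of_eq[of "borel :: real measure"] by simp
  have "space R = UNIV" using sets_eq_imp_space_eq[OF sets] by simp
  then have "emeasure R (space R) \<noteq> \<infinity>"
    using R[of UNIV] by (simp add: P.emeasure_eq_measure Q.emeasure_eq_measure)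
  then have "finite_borel_measure R"
    by (intro finite_borel_measure.intro finite_measureI finite_borel_measure_axioms.intro sets)
  moreover have "measure R A = measure P (?I \<inter> A) + measure Q (?I \<inter> A)" if "A \<in> sets borel" for A
  proof -
    interpret R: finite_borel_measure R by fact
    show ?thesis using R[OF that]
      by (simp add: R.emeasure_eq_measure P.emeasure_eq_measure Q.emeasure_eq_measure flip: ennreal_plus)
  qed
  ultimately show ?thesis by (rule that)
qed

lemma set_integral_sum:
  fixes f :: "real \<Rightarrow> 'b::{banach,second_countable_topology}"
  assumes "finite_borel_measure P" "finite_borel_measure Q" "finite_borel_measure R"
    and R: "\<And>A. A \<in> sets borel \<Longrightarrow> measure R A = measure P ({-1..0} \<inter> A) + measure Q ({-1..0} \<inter> A)"
    and f: "integrable R f"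
  shows "set_integrable P {-1..0} f \<and> set_integrable Q {-1..0} f \<and>
    integral\<^sup>L R f = (LINT \<theta>:{-1..0}|P. f \<theta>) + (LINT \<theta>:{-1..0}|Q. f \<theta>)"
proof -
  interpret P: finite_borel_measure P by fact
  interpret Q: finite_borel_measure Q by fact
  interpret R: finite_borel_measure R by fact
  let ?I = "{-1..0::real}"
  have sp: "space P = UNIV" "space Q = UNIV" "space R = UNIV"
    by (fact P.borel_UNIV Q.borel_UNIV R.borel_UNIV)+
  from f show ?thesis
  proof induct
    case (base A c)
    then have A: "A \<in> sets borel" using R.M_is_borel by simp
    then have "?I \<inter> A \<in> sets borel" by auto
    then have AA: "?I \<inter> A \<in> sets P" "?I \<inter> A \<in> sets Q" "A \<in> sets R"
      using A P.M_is_borel Q.M_is_borel R.M_is_borel by auto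
    have eq: "indicator ?I x *\<^sub>R (indicator A x *\<^sub>R c) = indicator (?I \<inter> A) x *\<^sub>R c" for x
      by (simp add: indicator_inter_arith)
    show ?case unfolding set_integrable_def set_lebesgue_integral_def eq
      using AA R[OF A] by (auto simp: sp P.emeasure_eq_measure Q.emeasure_eq_measure R.emeasure_eq_measure
           scaleR_add_left)
  next
    case (add f g)
    then show ?case by (auto simp: set_integral_add algebra_simps)
  next
    case (lim f s)
    have m: "f \<in> borel_measurable borel" "\<And>i. s i \<in> borel_measurable borel"
      using borel_measurable_integrable[OF lim(5)] borel_measurable_integrable[OF lim(1)]
      by (simp_all add: measurable_cong_sets[OF R.M_is_borel refl])
    have *: "set_integrable M ?I f \<and> (\<lambda>i. LINT \<theta>:?I|M. s i \<theta>) \<longlonglongrightarrow> (LINT \<theta>:?I|M. f \<theta>)"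
      if M: "finite_borel_measure M" and si: "\<And>i. set_integrable M ?I (s i)"
        and fI: "set_integrable M ?I f" for M
    proof -
      interpret M: finite_borel_measure M by fact
      have mm: "(\<lambda>x. indicator ?I x *\<^sub>R f x) \<in> borel_measurable M" 
         "\<And>i. (\<lambda>x. indicator ?I x *\<^sub>R s i x) \<in> borel_measurable M"
        using m by (auto simp: measurable_cong_sets[OF M.M_is_borel refl])
      have "(\<lambda>i. LINT \<theta>:?I|M. s i \<theta>) \<longlonglongrightarrow> (LINT \<theta>:?I|M. f \<theta>)"
        unfolding set_lebesgue_integral_def
      proof (rule integral_dominated_convergence[where w = "\<lambda>x. 2 * norm (indicator ?I x *\<^sub>R f x)"])
        show "integrable M (\<lambda>x. 2 * norm (indicator ?I x *\<^sub>R f x))"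
          using integrable_norm[OF fI[unfolded set_integrable_def]] by (rule integrable_mult_right)
        show "AE x in M. (\<lambda>i. indicator ?I x *\<^sub>R s i x) \<longlonglongrightarrow> indicator ?I x *\<^sub>R f x"
          using lim(3) sp by (auto intro!: tendsto_intros)
        show "AE x in M. norm (indicator ?I x *\<^sub>R s i x) \<le> 2 * norm (indicator ?I x *\<^sub>R f x)" for i
          using lim(4) sp by (auto simp: indicator_def)
      qed (use mm in auto)
      then show ?thesis using fI by blast
    qed
    have nn: "nn_integral R h = (\<integral>\<^sup>+x. indicator ?I x * h x \<partial>P) + (\<integral>\<^sup>+x. indicator ?I x * h x \<partial>Q)"
      if "h \<in> borel_measurable borel" for h :: "real \<Rightarrow> ennreal"
      using that
    proof induct
      case (cong f g) then show ?case by (metis (mono_tags, lifting) nn_integral_cong space_borel UNIV_I)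
    next
      case (set A)
      then have "?I \<inter> A \<in> sets borel" by auto
      then have AA: "?I \<inter> A \<in> sets P" "?I \<inter> A \<in> sets Q" "A \<in> sets R"
        using set P.M_is_borel Q.M_is_borel R.M_is_borel by auto
      have eq: "(indicator ?I x * indicator A x :: ennreal) = indicator (?I \<inter> A) x" for x
        by (simp add: indicator_inter_arith)
      show ?case using AA R[OF set] 
        by (simp add: eq P.emeasure_eq_measure Q.emeasure_eq_measure R.emeasure_eq_measure)
    next
      case (mult u v)
      have 1: "indicator ?I x * (v * u x) = v * (indicator ?I x * u x)" for x
        by (simp add: ac_simps)
      have 2: "(\<lambda>x. indicator ?I x * u x) \<in> borel_measurable borel" "u \<in> borel_measurable borel"
        using mult by auto
      show ?case unfolding 1
        using 2 mult(4)
        by (simp add: nn_integral_cmult measurable_cong_sets[OF P.M_is_borel refl] measurable_cong_sets[OF Q.M_is_borel refl]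
           measurable_cong_sets[OF R.M_is_borel refl] distrib_left)
    next
      case (add u v)
      have 2: "(\<lambda>x. indicator ?I x * u x) \<in> borel_measurable borel" "u \<in> borel_measurable borel"
         "(\<lambda>x. indicator ?I x * v x) \<in> borel_measurable borel" "v \<in> borel_measurable borel"
        using add by auto
      have "nn_integral M (\<lambda>x. indicator ?I x * (v x + u x)) =
          nn_integral M (\<lambda>x. indicator ?I x * v x) + nn_integral M (\<lambda>x. indicator ?I x * u x)"
        if "sets M = sets borel" for M
        unfolding distrib_left by (rule nn_integral_add) (use 2 in \<open>simp_all add: measurable_cong_sets[OF that refl]\<close>)
      note eq = this[OF P.M_is_borel] this[OF Q.M_is_borel]
      have "nn_integral R (\<lambda>x. v x + u x) = nn_integral R v + nn_integral R u"
        by (rule nn_integral_add) (use 2 in \<open>simp_all add: measurable_cong_sets[OF R.M_is_borel refl]\<close>)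
      then show ?case unfolding eq add(3,7) by (simp add: ac_simps)
    next
      case (seq U)
      have 2: "(\<lambda>x. indicator ?I x * U i x) \<in> borel_measurable borel" "U i \<in> borel_measurable borel" for i
        using seq by auto
      have inc: "incseq (\<lambda>i x. indicator ?I x * U i x)"
        using seq by (auto simp: incseq_def le_fun_def intro!: mult_left_mono)
      have 3: "indicator ?I x * (SUP i. U i) x = (SUP i. indicator ?I x * U i x)" for x
        by (simp add: SUP_mult_left_ennreal image_comp)
      have inc': "incseq (\<lambda>i. \<integral>\<^sup>+x. indicator ?I x * U i x \<partial>M)" for M
        using inc by (auto simp: incseq_def le_fun_def intro!: nn_integral_mono)
      have "nn_integral R (SUP i. U i) = (SUP i. nn_integral R (U i))"
        unfolding SUP_apply by (rule nn_integral_monotone_convergence_SUP)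
          (use seq 2 in \<open>auto simp: measurable_cong_sets[OF R.M_is_borel refl]\<close>)
      also have "\<dots> = (SUP i. (\<integral>\<^sup>+x. indicator ?I x * U i x \<partial>P) + (\<integral>\<^sup>+x. indicator ?I x * U i x \<partial>Q))"
        using seq by simp
      also have "\<dots> = (SUP i. (\<integral>\<^sup>+x. indicator ?I x * U i x \<partial>P)) + (SUP i. (\<integral>\<^sup>+x. indicator ?I x * U i x \<partial>Q))"
        by (rule ennreal_SUP_add[OF inc' inc'])
      also have "\<dots> = (\<integral>\<^sup>+x. (SUP i. indicator ?I x * U i x) \<partial>P) + (\<integral>\<^sup>+x. (SUP i. indicator ?I x * U i x) \<partial>Q)"
        by (intro arg_cong2[where f="(+)"] nn_integral_monotone_convergence_SUP[symmetric])
          (use inc 2 in \<open>auto simp: measurable_cong_sets[OF P.M_is_borel refl] measurable_cong_sets[OF Q.M_is_borel refl]\<close>)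
      finally show ?case unfolding 3 .
    qed
    have ind: "indicator ?I x * ennreal (norm (f x)) = ennreal (norm (indicator ?I x *\<^sub>R f x))" for x
      by (simp add: indicator_def)
    have "(\<integral>\<^sup>+x. norm (f x) \<partial>R) < \<infinity>"
      using lim(5) by (simp add: integrable_iff_bounded)
    also have "(\<integral>\<^sup>+x. norm (f x) \<partial>R) = (\<integral>\<^sup>+x. norm (indicator ?I x *\<^sub>R f x) \<partial>P) + (\<integral>\<^sup>+x. norm (indicator ?I x *\<^sub>R f x) \<partial>Q)"
      using m by (subst nn) (auto simp: ind)
    finally have fin: "(\<integral>\<^sup>+x. norm (indicator ?I x *\<^sub>R f x) \<partial>P) < \<infinity>" "(\<integral>\<^sup>+x. norm (indicator ?I x *\<^sub>R f x) \<partial>Q) < \<infinity>"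
      by (auto simp: less_top)
    have f_int: "set_integrable P ?I f" "set_integrable Q ?I f"
      unfolding set_integrable_def integrable_iff_bounded using fin m
      by (auto simp: measurable_cong_sets[OF P.M_is_borel refl] measurable_cong_sets[OF Q.M_is_borel refl])
    have "(\<lambda>i. integral\<^sup>L R (s i)) \<longlonglongrightarrow> (LINT \<theta>:?I|P. f \<theta>) + (LINT \<theta>:?I|Q. f \<theta>)"
      using *[OF \<open>finite_borel_measure P\<close> _ f_int(1)] *[OF \<open>finite_borel_measure Q\<close> _ f_int(2)] lim(2)
      by (auto intro!: tendsto_add)
    moreover have "(\<lambda>i. integral\<^sup>L R (s i)) \<longlonglongrightarrow> integral\<^sup>L R f"
    proof (rule integral_dominated_convergence[where w = "\<lambda>x. 2 * norm (f x)"])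
    qed (use lim in \<open>auto\<close>)
    ultimately show ?case using f_int LIMSEQ_unique by blast
  qed
qed

lemma represents_right_limit:
  assumes "represents g P Q"
  shows "(g \<longlongrightarrow> measure P {-1} - measure Q {-1}) (at_right (-1))"
proof -
  have *: "((\<lambda>t. measure P {-1..t}) \<longlongrightarrow> measure P {-1}) (at_right (-1))"
    if "finite_borel_measure P" for P
  proof -
    interpret finite_borel_measure P by fact
    have "measure P {-1..t} = cdf P t - measure P {..<-1}" if "t \<ge> -1" for t
    proof -
      have "{..t} = {..<-1} \<union> {-1..t}" using that by auto
      then show ?thesis unfolding cdf_def
        by (simp, subst finite_measure_Union) auto
    qed
    note eq = this
    have "((\<lambda>t. cdf P t - measure P {..<-1}) \<longlongrightarrow> cdf P (-1) - measure P {..<-1}) (at_right (-1))"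
      using cdf_is_right_cont[of "-1"] by (intro tendsto_intros) (simp add: continuous_within)
    moreover have "\<forall>\<^sub>F t in at_right (-1). cdf P t - measure P {..<-1} = measure P {-1..t}"
      by (rule eventually_at_rightI[of _ 0]) (use eq in auto)
    ultimately show ?thesis using eq[of "-1"] by (simp add: tendsto_cong)
  qed
  have "\<forall>\<^sub>F t in at_right (-1). measure P {-1..t} - measure Q {-1..t} = g t"
    by (rule eventually_at_rightI[of _ 0]) (use assms in \<open>auto simp: represents_def\<close>)
  moreover have "((\<lambda>t. measure P {-1..t} - measure Q {-1..t}) \<longlongrightarrow> measure P {-1} - measure Q {-1}) (at_right (-1))"
    using assms by (intro tendsto_intros *) (auto simp: represents_def)
  ultimately show ?thesis by (simp add: tendsto_cong)
qed

lemma stieltjes_integral_eq: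
  fixes f :: "real \<Rightarrow> 'b::{banach,second_countable_topology}"
  assumes "represents g P Q" and "continuous_on {-1..0} f"
  shows "stieltjes_integral g f = (LINT \<theta>:{-1..0}|P. f \<theta>) - (LINT \<theta>:{-1..0}|Q. f \<theta>)"
proof -
  let ?I = "{-1..0::real}"
  obtain P' Q' where PQ': "(SOME (P, Q). represents g P Q) = (P', Q')" by fastforce
  have rep': "represents g P' Q'"
    using someI[of "\<lambda>(P, Q). represents g P Q" "(P, Q)"] assms(1) PQ' by auto
  have fin: "finite_borel_measure P" "finite_borel_measure Q" "finite_borel_measure P'" "finite_borel_measure Q'"
    using assms(1) rep' by (auto simp: represents_def)
  obtain R1 where R1: "finite_borel_measure R1"
    "\<And>A. A \<in> sets borel \<Longrightarrow> measure R1 A = measure P (?I \<inter> A) + measure Q' (?I \<inter> A)"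
    using sum_of_restricted_measures[OF fin(1,4)] by blast
  obtain R2 where R2: "finite_borel_measure R2"
    "\<And>A. A \<in> sets borel \<Longrightarrow> measure R2 A = measure P' (?I \<inter> A) + measure Q (?I \<inter> A)"
    using sum_of_restricted_measures[OF fin(3,2)] by blast
  have "measure P {-1} - measure Q {-1} = measure P' {-1} - measure Q' {-1}"
    using tendsto_unique[OF _ represents_right_limit[OF assms(1)] represents_right_limit[OF rep']]
    by simp
  then have eq1: "measure P {-1..t} + measure Q' {-1..t} = measure P' {-1..t} + measure Q {-1..t}"
    if "t \<in> {-1..0}" for t
  proof (cases "t = -1")
    case False
    then have t: "t \<in> {-1<..0}" using that by auto
    have "measure P {-1..t} - measure Q {-1..t} = measure P' {-1..t} - measure Q' {-1..t}"
      using assms(1) rep' t unfolding represents_def by metis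
    then show ?thesis by simp
  qed simp
  have "cdf R1 t = cdf R2 t" for t
  proof -
    consider "t < -1" | "t \<in> {-1..0}" | "t > 0" by fastforce
    then show ?thesis
    proof cases
      case 1
      then have "?I \<inter> {..t} = {}" by auto
      then show ?thesis by (simp add: cdf_def R1(2) R2(2))
    next
      case 2
      then have e: "?I \<inter> {..t} = {-1..t}" by auto
      show ?thesis using eq1[OF 2] unfolding cdf_def R1(2)[OF atMost_borel] R2(2)[OF atMost_borel] e by simp
    next
      case 3
      then have e: "?I \<inter> {..t} = {-1..0}" by auto
      show ?thesis using eq1[of 0] unfolding cdf_def R1(2)[OF atMost_borel] R2(2)[OF atMost_borel] e by simp
    qed
  qed
  then have RR: "R1 = R2" using cdf_unique'[OF R1(1) R2(1)] by blast
  let ?f = "\<lambda>x. indicator ?I x *\<^sub>R f x"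
  have m: "?f \<in> borel_measurable borel"
    using assms(2) by (intro borel_measurable_continuous_on_indicator) auto
  obtain B where B: "\<And>x. x \<in> ?I \<Longrightarrow> norm (f x) \<le> B"
    using compact_imp_bounded[OF compact_continuous_image[OF assms(2) compact_Icc]]
    unfolding bounded_iff by blast
  interpret R1: finite_borel_measure R1 by (fact R1(1))
  have int: "integrable R1 ?f"
  proof (rule R1.integrable_const_bound[where B = "max B 0"])
    show "AE x in R1. norm (?f x) \<le> max B 0"
      using B by (auto simp: indicator_def le_max_iff_disj intro!: AE_I2)
  qed (use m in \<open>simp add: measurable_cong_sets[OF R1.M_is_borel refl]\<close>)
  have ff: "(LINT \<theta>:?I|M. ?f \<theta>) = (LINT \<theta>:?I|M. f \<theta>)" for M
    unfolding set_lebesgue_integral_def by (intro arg_cong[where f="integral\<^sup>L M"]) (auto simp: indicator_def)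
  have "(LINT \<theta>:?I|P. f \<theta>) + (LINT \<theta>:?I|Q'. f \<theta>) = (LINT \<theta>:?I|P'. f \<theta>) + (LINT \<theta>:?I|Q. f \<theta>)"
    using set_integral_sum[OF fin(1,4) R1 int] set_integral_sum[OF fin(3,2) R2 int[unfolded RR]] RR
    unfolding ff by auto
  then show ?thesis
    unfolding stieltjes_integral_def PQ' by (simp add: algebra_simps)
qed

lemma measure_of_mono:
  fixes p :: "real \<Rightarrow> real"
  assumes mono: "\<And>s t. -1 \<le> s \<Longrightarrow> s \<le> t \<Longrightarrow> t \<le> 0 \<Longrightarrow> p s \<le> p t" and nonneg: "0 \<le> p (-1)"
  obtains P where "finite_borel_measure P" "measure P {-1..0} = p 0"
    "\<And>t. t \<in> {-1<..<0} \<Longrightarrow> (p \<longlongrightarrow> measure P {-1..t}) (at_right t)"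
proof -
  define F where "F t = (if t < -1 then 0 else if t < 0 then (INF s\<in>{t<..0}. p s) else p 0)" for t
  have bdd: "bdd_below (p ` {t<..0})" if "-1 \<le> t" for t
    using mono[of "-1"] that by (intro bdd_belowI2[of _ "p (-1)"]) auto
  have F_le: "F t \<le> p s" if "-1 \<le> t" "t < s" "s \<le> 0" for s t
    using that bdd[of t] by (auto simp: F_def intro!: cINF_lower)
  have F_ge: "p t \<le> F t" if "-1 \<le> t" "t \<le> 0" for t
    using that by (auto simp: F_def intro!: cINF_greatest mono)
  have F_nonneg: "0 \<le> F t" for t
  proof -
    consider "t < -1" | "-1 \<le> t" "t \<le> 0" | "t > 0" by linarith
    then show ?thesis
    proof cases
      case 2
      then show ?thesis using F_ge[of t] mono[of "-1" t] nonneg by linarith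
    next
      case 3
      then show ?thesis using mono[of "-1" 0] nonneg by (simp add: F_def)
    qed (simp add: F_def)
  qed
  have F_mono: "F s \<le> F t" if "s \<le> t" for s t
  proof -
    have "s = t \<or> s < -1 \<or> (-1 \<le> s \<and> s < t \<and> t \<le> 0) \<or>
        (-1 \<le> s \<and> s < 0 \<and> 0 < t) \<or> (0 \<le> s \<and> s < t)" using that by linarith
    then consider "s = t" | "s < -1" | "-1 \<le> s" "s < t" "t \<le> 0" | "-1 \<le> s" "s < 0" "0 < t" | "0 \<le> s" "s < t"
      by blast
    then show ?thesis
    proof cases
      case 2 then show ?thesis using F_nonneg[of t] by (simp add: F_def)
    next
      case 3 then show ?thesis using F_le[of s t] F_ge[of t] by linarith
    next
      case 4 then show ?thesis using F_le[of s 0] by (simp add: F_def)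
    qed (auto simp: F_def)
  qed
  have right: "(p \<longlongrightarrow> F t) (at_right t)" "(F \<longlongrightarrow> F t) (at_right t)" if t: "-1 \<le> t" "t < 0" for t
  proof -
    have *: "\<exists>b>t. \<forall>u. t < u \<and> u < b \<longrightarrow> F t \<le> p u \<and> p u < a \<and> F t \<le> F u \<and> F u < a" if "a > F t" for a
    proof -
      from that t have "(INF s\<in>{t<..0}. p s) < a" by (simp add: F_def)
      moreover have "{t<..0} \<noteq> {}" using t by auto
      ultimately obtain s where s: "s \<in> {t<..0}" "p s < a"
        using cINF_less_iff[OF _ bdd[OF t(1)]] by blast
      have "F t \<le> p u \<and> p u < a \<and> F t \<le> F u \<and> F u < a" if "t < u" "u < s" for u
        using s that t F_le[of t u] mono[of u s] F_mono[of t u] F_le[of u s] by auto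
      then show ?thesis using s by auto
    qed
    show "(p \<longlongrightarrow> F t) (at_right t)"
    proof (rule order_tendstoI)
      fix a assume "a < F t"
      moreover obtain b where "b > t" "\<forall>u. t < u \<and> u < b \<longrightarrow> F t \<le> p u" using *[of "F t + 1"] by auto
      ultimately show "\<forall>\<^sub>F x in at_right t. a < p x"
        by (intro eventually_at_rightI[of _ b]) force+
    next
      fix a assume "F t < a"
      then obtain b where "b > t" "\<forall>u. t < u \<and> u < b \<longrightarrow> p u < a" using *[of a] by auto
      then show "\<forall>\<^sub>F x in at_right t. p x < a"
        by (intro eventually_at_rightI[of _ b]) auto
    qed
    show "(F \<longlongrightarrow> F t) (at_right t)"
    proof (rule order_tendstoI)
      fix a assume "a < F t"
      moreover obtain b where "b > t" "\<forall>u. t < u \<and> u < b \<longrightarrow> F t \<le> F u" using *[of "F t + 1"] by auto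
      ultimately show "\<forall>\<^sub>F x in at_right t. a < F x"
        by (intro eventually_at_rightI[of _ b]) force+
    next
      fix a assume "F t < a"
      then obtain b where "b > t" "\<forall>u. t < u \<and> u < b \<longrightarrow> F u < a" using *[of a] by auto
      then show "\<forall>\<^sub>F x in at_right t. F x < a"
        by (intro eventually_at_rightI[of _ b]) auto
    qed
  qed
  have F_right: "continuous (at_right t) F" for t
    unfolding continuous_within
  proof -
    consider "t < -1" | "-1 \<le> t" "t < 0" | "0 \<le> t" by linarith
    then show "(F \<longlongrightarrow> F t) (at_right t)"
    proof cases
      case 1
      then have "\<forall>\<^sub>F u in at_right t. F t = F u"
        by (intro eventually_at_rightI[of _ "-1"]) (auto simp: F_def)
      then show ?thesis by (rule Lim_transform_eventually[OF tendsto_const])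
    next
      case 3
      then have "\<forall>\<^sub>F u in at_right t. F t = F u"
        by (intro eventually_at_rightI[of _ "t+1"]) (auto simp: F_def)
      then show ?thesis by (rule Lim_transform_eventually[OF tendsto_const])
    qed (rule right)
  qed
  have bot: "(F \<longlongrightarrow> 0) at_bot"
  proof (rule Lim_transform_eventually[OF tendsto_const])
    show "\<forall>\<^sub>F x in at_bot. 0 = F x" using eventually_le_at_bot[of "-2"]
      by (rule eventually_mono) (simp add: F_def)
  qed
  have top: "(F \<longlongrightarrow> p 0) at_top"
  proof (rule Lim_transform_eventually[OF tendsto_const])
    show "\<forall>\<^sub>F x in at_top. p 0 = F x" using eventually_ge_at_top[of "0::real"]
      by (rule eventually_mono) (simp add: F_def)
  qed
  have p0: "0 \<le> p 0" using mono[of "-1" 0] nonneg by linarith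
  define P where "P = interval_measure F"
  have P: "finite_borel_measure P" unfolding P_def
    by (rule finite_borel_measure_interval_measure[OF F_mono F_right bot top p0])
  interpret P: finite_borel_measure P by (fact P)
  have cdf: "cdf P t = F t" for t
  proof -
    have *: "F t - F s = cdf P t - cdf P s" if "s < t" for s
      using P.cdf_diff_eq[OF that] measure_interval_measure_Ioc[of s t F] F_mono F_right that
      unfolding P_def by simp
    have ev: "\<forall>\<^sub>F s in at_bot. F t - F s = cdf P t - cdf P s"
      by (rule eventually_mono[OF eventually_gt_at_bot[of t] *])
    have "((\<lambda>s. F t - F s) \<longlongrightarrow> F t - 0) at_bot" by (intro tendsto_intros bot)
    then have "((\<lambda>s. cdf P t - cdf P s) \<longlongrightarrow> F t - 0) at_bot"
      using ev by (rule Lim_transform_eventually)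
    moreover have "((\<lambda>s. cdf P t - cdf P s) \<longlongrightarrow> cdf P t - 0) at_bot"
      by (intro tendsto_intros P.cdf_lim_at_bot)
    ultimately show ?thesis using tendsto_unique[of at_bot] by force
  qed
  have left: "measure P {..<-1} = 0"
  proof -
    have "\<forall>\<^sub>F s in at_left (-1). cdf P s = 0"
      by (rule eventually_at_leftI[of "-2"]) (auto simp: cdf F_def)
    then have "(cdf P \<longlongrightarrow> 0) (at_left (-1))" by (simp add: tendsto_eventually)
    then show ?thesis using tendsto_unique[OF _ P.cdf_at_left[of "-1"]] by force
  qed
  have meas: "measure P {-1..t} = F t" if "-1 \<le> t" for t
  proof -
    have "{..t} = {..<-1} \<union> {-1..t}" using that by auto
    then have "cdf P t = measure P {..<-1} + measure P {-1..t}"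
      unfolding cdf_def by (simp, subst P.finite_measure_Union) auto
    then show ?thesis using left cdf by simp
  qed
  show ?thesis
    by (rule that[of P]) (use P meas right in \<open>auto simp: F_def\<close>)
qed

lemma represents_exists:
  fixes nrm :: "'a::minus \<Rightarrow> real" and f :: "real \<Rightarrow> 'a"
  assumes nrm: "\<And>x. 0 \<le> nrm x" and var: "variation nrm f < \<infinity>"
    and g: "\<And>s t. -1 \<le> s \<Longrightarrow> s < t \<Longrightarrow> t \<le> 0 \<Longrightarrow> \<bar>g t - g s\<bar> \<le> C * nrm (f t - f s)"
    and C: "0 \<le> C" and g0: "g (-1) = 0"
    and right: "\<And>t. t \<in> {-1<..<0} \<Longrightarrow> (g \<longlongrightarrow> g t) (at_right t)"
  shows "\<exists>P Q. represents g P Q"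
proof -
  define S where "S t = {(\<Sum>i=1..k. nrm (f (\<tau> (i + 1)) - f (\<tau> i))) | (k::nat) (\<tau> :: nat \<Rightarrow> real).
     \<tau> 1 = -1 \<and> \<tau> (k + 1) = t \<and> (\<forall>i\<in>{1..k}. \<tau> i < \<tau> (i + 1))}" for t
  have var_eq: "variation nrm f = Sup (ereal ` S 0)"
    unfolding variation_def S_def by (rule arg_cong[where f = Sup]) auto
  have step: "a + nrm (f t - f s) \<in> S t" if aS: "a \<in> S s" and st: "s < t" for a s t
  proof -
    obtain k and \<tau> :: "nat \<Rightarrow> real" where a: "a = (\<Sum>i=1..k. nrm (f (\<tau> (i + 1)) - f (\<tau> i)))" and
      tau: "\<tau> 1 = -1" "\<tau> (k + 1) = s" "\<forall>i\<in>{1..k}. \<tau> i < \<tau> (i + 1)"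
      using aS unfolding S_def by blast
    let ?\<tau> = "\<tau>(k + 2 := t)"
    have "(\<Sum>i=1..k+1. nrm (f (?\<tau> (i + 1)) - f (?\<tau> i))) = a + nrm (f t - f s)"
      using tau(2) by (simp add: a)
    moreover have "?\<tau> 1 = -1" "?\<tau> (k + 1 + 1) = t" "\<forall>i\<in>{1..k+1}. ?\<tau> i < ?\<tau> (i + 1)"
      using tau st by (auto simp: le_Suc_eq)
    ultimately show ?thesis unfolding S_def by (intro CollectI exI[of _ "k+1"] exI[of _ ?\<tau>]) auto
  qed
  have S1: "0 \<in> S (-1)"
    unfolding S_def by (intro CollectI exI[of _ 0] exI[of _ "\<lambda>_. -1"]) auto
  have nonempty: "S t \<noteq> {}" if "-1 \<le> t" for t
    using S1 step[OF S1, of t] that by (cases "t = -1") auto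
  obtain B where B: "a \<le> B" if "a \<in> S 0" for a
  proof -
    obtain a0 where "a0 \<in> S 0" using nonempty[of 0] by auto
    then have "ereal a0 \<le> variation nrm f" unfolding var_eq by (intro Sup_upper) auto
    then obtain B where "variation nrm f = ereal B" using var by (cases "variation nrm f") auto
    then have "a \<le> B" if "a \<in> S 0" for a
      using Sup_upper[of "ereal a" "ereal ` S 0"] that unfolding var_eq by auto
    then show ?thesis using that by blast
  qed
  have bdd: "bdd_above (S t)" if "t \<le> 0" for t
  proof (rule bdd_aboveI[of _ B])
    fix a assume "a \<in> S t"
    then show "a \<le> B"
      using B[of a] B[OF step[of a t 0]] nrm[of "f 0 - f t"] that by (cases "t = 0") auto
  qed
  define p where "p t = C * Sup (S t)" for t
  have p: "p s + \<bar>g t - g s\<bar> \<le> p t" if "-1 \<le> s" "s < t" "t \<le> 0" for s t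
  proof -
    have "Sup (S s) \<le> Sup (S t) - nrm (f t - f s)"
      using that by (intro cSup_least nonempty) (auto simp: le_diff_eq intro!: cSup_upper step bdd)
    then have "Sup (S s) + nrm (f t - f s) \<le> Sup (S t)" by simp
    then have "C * Sup (S s) + C * nrm (f t - f s) \<le> C * Sup (S t)"
      using mult_left_mono[OF _ C] by (metis distrib_left)
    then show ?thesis using g[OF that] unfolding p_def by linarith
  qed
  have p0: "0 \<le> p (-1)"
    unfolding p_def using C S1 bdd[of "-1"] by (auto intro!: mult_nonneg_nonneg cSup_upper)
  define q where "q t = p t - g t" for t
  obtain P where P: "finite_borel_measure P" "measure P {-1..0} = p 0"
    "\<And>t. t \<in> {-1<..<0} \<Longrightarrow> (p \<longlongrightarrow> measure P {-1..t}) (at_right t)"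
  proof (rule measure_of_mono[of p])
    fix s t :: real assume "-1 \<le> s" "s \<le> t" "t \<le> 0"
    then show "p s \<le> p t" using p[of s t] by (cases "s = t") auto
  qed (use p0 in auto)
  obtain Q where Q: "finite_borel_measure Q" "measure Q {-1..0} = q 0"
    "\<And>t. t \<in> {-1<..<0} \<Longrightarrow> (q \<longlongrightarrow> measure Q {-1..t}) (at_right t)"
  proof (rule measure_of_mono[of q])
    fix s t :: real assume "-1 \<le> s" "s \<le> t" "t \<le> 0"
    then show "q s \<le> q t" using p[of s t] unfolding q_def by (cases "s = t") auto
  qed (use p0 g0 in \<open>auto simp: q_def\<close>)
  have "g t = measure P {-1..t} - measure Q {-1..t}" if "t \<in> {-1<..0}" for t
  proof (cases "t = 0")
    case True then show ?thesis using P(2) Q(2) by (simp add: q_def)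
  next
    case False
    then have t: "t \<in> {-1<..<0}" using that by auto
    have "((\<lambda>t. p t - q t) \<longlongrightarrow> measure P {-1..t} - measure Q {-1..t}) (at_right t)"
      using P(3) Q(3) t by (intro tendsto_intros) auto
    then have "(g \<longlongrightarrow> measure P {-1..t} - measure Q {-1..t}) (at_right t)" by (simp add: q_def)
    then show ?thesis using tendsto_unique[OF _ right[OF t]] by force
  qed
  then show ?thesis unfolding represents_def using P(1) Q(1) by blast
qed

lemma matrix_norm_entry_bound:
  fixes N :: "real ^ 'n \<Rightarrow> real"
  assumes "is_norm N"
  obtains C where "0 \<le> C" "\<And>(A :: real ^ 'n ^ 'n) i j. \<bar>A $ i $ j\<bar> \<le> C * matrix_norm N A"
    "\<And>A :: real ^ 'n ^ 'n. 0 \<le> matrix_norm N A"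
proof -
  have nn: "0 \<le> N x" and N0: "N x = 0 \<longleftrightarrow> x = 0" and sc: "N (c *\<^sub>R x) = \<bar>c\<bar> * N x"
    and tri: "N (x + y) \<le> N x + N y" for x y c
    using assms unfolding is_norm_def by auto
  have N00: "N 0 = 0" using N0[of 0] by simp
  define K where "K = (\<Sum>i\<in>UNIV. N (axis i 1))"
  have "N (\<Sum>i\<in>F. v i) \<le> (\<Sum>i\<in>F. N (v i))" if "finite F" for F and v :: "'n \<Rightarrow> real ^ 'n"
    using that
  proof induct
    case empty then show ?case using N0[of 0] by simp
  next
    case (insert x F) then show ?case using tri[of "v x" "sum v F"] by simp
  qed
  note N_sum = this
  have K: "N x \<le> K * norm x" for x
  proof -
    have "N x = N (\<Sum>i\<in>UNIV. (x $ i) *\<^sub>R axis i 1)"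
      by (simp add: scalar_mult_eq_scaleR[symmetric] basis_expansion)
    also have "\<dots> \<le> (\<Sum>i\<in>UNIV. N ((x $ i) *\<^sub>R axis i 1))" by (rule N_sum) simp
    also have "\<dots> \<le> (\<Sum>i\<in>UNIV. norm x * N (axis i 1))"
      using component_le_norm_cart[of x] nn by (intro sum_mono) (auto simp: sc intro!: mult_right_mono)
    finally show ?thesis by (simp add: K_def sum_distrib_left mult.commute)
  qed
  have K0: "0 \<le> K" using nn by (auto simp: K_def intro!: sum_nonneg)
  have cont: "continuous_on UNIV N"
  proof -
    have "\<bar>N x - N y\<bar> \<le> K * norm (x - y)" for x y
      using tri[of "x - y" y] tri[of "y - x" x] K[of "x - y"] K[of "y - x"] by (auto simp: norm_minus_commute)
    then have "K-lipschitz_on UNIV N" using K0 by (auto simp: lipschitz_on_def dist_norm)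
    then show ?thesis by (rule lipschitz_on_continuous_on)
  qed
  have ne: "sphere 0 1 \<noteq> ({} :: (real ^ 'n) set)" using sphere_eq_empty by simp
  obtain z where z: "z \<in> sphere 0 1" "\<And>y. y \<in> sphere 0 1 \<Longrightarrow> N z \<le> N y"
    using continuous_attains_inf[OF compact_sphere ne continuous_on_subset[OF cont]] by auto
  define c where "c = N z"
  have c: "0 < c" using z(1) nn[of z] N0[of z] unfolding c_def by (cases "N z = 0") auto
  have low: "c * norm x \<le> N x" for x
  proof (cases "x = 0")
    case False
    then have "c \<le> N ((1 / norm x) *\<^sub>R x)" unfolding c_def by (intro z(2)) simp
    then show ?thesis using False by (simp add: sc field_simps)
  qed (simp add: nn)
  have bdd: "bdd_above ((\<lambda>v. N (A *v v)) ` {v. N v = 1})" for A :: "real ^ 'n ^ 'n"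
  proof -
    obtain b where b: "\<And>x. norm (A *v x) \<le> norm x * b" 
      using bounded_linear.pos_bounded[OF matrix_vector_mul_bounded_linear[of A]] by blast
    have "N (A *v v) \<le> K * (1 / c * \<bar>b\<bar>)" if "N v = 1" for v
    proof -
      have "norm v \<le> 1 / c" using low[of v] that c by (simp add: field_simps)
      then have "norm v * b \<le> 1 / c * \<bar>b\<bar>"
        by (meson abs_ge_self abs_ge_zero mult_mono norm_ge_zero order_trans mult_left_mono mult_right_mono)
      then show ?thesis using K[of "A *v v"] b[of v] K0 mult_left_mono order_trans by metis
    qed
    then show ?thesis by (auto intro!: bdd_aboveI2)
  qed
  have mn: "N (A *v v) \<le> matrix_norm N A * N v" for A :: "real ^ 'n ^ 'n" and v
  proof (cases "v = 0")
    case False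
    then have Nv: "N v > 0" using nn[of v] N0[of v] by linarith
    have "N (A *v ((1 / N v) *\<^sub>R v)) \<le> matrix_norm N A"
      unfolding matrix_norm_def by (rule cSUP_upper[OF _ bdd]) (use Nv in \<open>simp add: sc\<close>)
    then show ?thesis using Nv by (simp add: sc matrix_vector_mult_scaleR field_simps)
  qed (simp add: N00)
  have mn0: "0 \<le> matrix_norm N A" for A :: "real ^ 'n ^ 'n"
  proof -
    have "z \<noteq> 0" using z(1) by auto
    then have "N z > 0" using c c_def by simp
    moreover have "0 \<le> matrix_norm N A * N z" using mn[of A z] nn[of "A *v z"] by linarith
    ultimately show ?thesis by (simp add: zero_le_mult_iff)
  qed
  have "\<bar>A $ i $ j\<bar> \<le> K / c * matrix_norm N A" for A :: "real ^ 'n ^ 'n" and i j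
  proof -
    have "A $ i $ j = (A *v axis j 1) $ i" by (simp add: matrix_vector_mult_basis column_def)
    then have "\<bar>A $ i $ j\<bar> \<le> norm (A *v axis j 1)" using component_le_norm_cart[of "A *v axis j 1" i] by simp
    moreover have "c * norm (A *v axis j 1) \<le> matrix_norm N A * K"
      using low[of "A *v axis j 1"] mn[of A "axis j 1"] K[of "axis j 1"] mn0[of A]
        mult_left_mono[of "N (axis j 1)" K "matrix_norm N A"] by simp
    ultimately have "c * \<bar>A $ i $ j\<bar> \<le> matrix_norm N A * K"
      using c by (meson mult_left_mono order_trans less_imp_le)
    then show ?thesis using c by (simp add: field_simps)
  qed
  then show ?thesis using that[of "K / c"] K0 c mn0 by auto
qed

lemma NBV_entry_represents:
  assumes "is_norm N" and "M \<in> NBV N"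
  shows "\<exists>P Q. represents (\<lambda>\<theta>. M \<theta> $ i $ j) P Q"
proof -
  obtain C where C: "0 \<le> C" "\<And>A i j. \<bar>A $ i $ j\<bar> \<le> C * matrix_norm N A" "\<And>A. 0 \<le> matrix_norm N A"
    using matrix_norm_entry_bound[OF assms(1)] by metis
  have M: "Var N M < \<infinity>" "M (-1) = 0" "\<And>t. t \<in> {-1<..<0} \<Longrightarrow> (M \<longlongrightarrow> M t) (at_right t)"
    using assms(2) by (auto simp: NBV_def continuous_within)
  show ?thesis
  proof (rule represents_exists[where nrm = "matrix_norm N" and f = M and C = C])
    show "\<bar>M t $ i $ j - M s $ i $ j\<bar> \<le> C * matrix_norm N (M t - M s)" for s t
      using C(2)[of "M t - M s"] by simp
    show "((\<lambda>\<theta>. M \<theta> $ i $ j) \<longlongrightarrow> M t $ i $ j) (at_right t)" if "t \<in> {-1<..<0}" for t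
      using M(3)[OF that] by (intro tendsto_intros)
  qed (use C M in auto)
qed

end

theory Submission
  imports Defs
begin

text \<open>
  Choose \<open>\<alpha>\<close> with \<open>S\<^sub>M < \<alpha> < 0\<close>. On the half-plane \<open>Re s \<ge> \<alpha>\<close> the integrand
  \<open>e\<^sup>s\<^sup>\<theta>\<close> is bounded by \<open>e\<^sup>-\<^sup>\<alpha>\<close> for \<open>\<theta> \<in> [-1,0]\<close>, so the matrices \<open>\<integral> e\<^sup>s\<^sup>\<theta> dM(\<theta>)\<close> stay in a bounded
  set and depend on \<open>M\<close> in a Lipschitz way with respect to the total variation, uniformly in \<open>s\<close>.
  The determinant is uniformly continuous on bounded sets, hence the lower bound of \<open>\<bar>\<Delta>\<^sub>M\<bar>\<close> on the
  half-plane survives small perturbations, which therefore have spectral abscissa at most \<open>\<alpha>\<close>.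
\<close>

section \<open>Uniform partitions of [-1,0] and their cells\<close>

text \<open>Points are numbered from 1, as in \<open>variation\<close>: the indices 1 to
  \<open>n + 2\<close> cut [-1,0] into \<open>n + 1\<close> equal pieces.\<close>

definition grid :: "nat \<Rightarrow> nat \<Rightarrow> real" where
  "grid n i = -1 + (real i - 1) / real (Suc n)"

text \<open>Half-open cells tile [-1,0] without overlap; the first one is closed so that an atom at
  -1 is not lost.\<close>

definition cell :: "nat \<Rightarrow> nat \<Rightarrow> real set" where
  "cell n i = (if i = 1 then {-1..grid n 2} else {grid n i<..grid n (i + 1)})"

text \<open>The ceiling matches cells closed on the right; \<open>max 1\<close> puts \<theta> = -1,
  where the ceiling is 0, into the first cell.\<close>

definition cell_index :: "nat \<Rightarrow> real \<Rightarrow> nat" where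
  "cell_index n \<theta> = max 1 (nat \<lceil>(\<theta> + 1) * real (Suc n)\<rceil>)"

lemma grid_1 [simp]: "grid n (Suc 0) = -1"
  by (simp add: grid_def)

lemma grid_last [simp]: "grid n (Suc (Suc n)) = 0"
  by (simp add: grid_def field_simps)

lemma grid_strict_mono: "i < j \<Longrightarrow> grid n i < grid n j"
  by (simp add: grid_def divide_strict_right_mono)

lemma grid_mono: "i \<le> j \<Longrightarrow> grid n i \<le> grid n j"
  by (simp add: grid_def divide_right_mono)

lemma grid_range: "1 \<le> i \<Longrightarrow> i \<le> Suc (Suc n) \<Longrightarrow> grid n i \<in> {-1..0}"
  using grid_mono[of 1 i n] grid_mono[of i "Suc (Suc n)" n] by simp

lemma cell_index_range:
  assumes "\<theta> \<in> {-1..0}"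
  shows "cell_index n \<theta> \<in> {1..Suc n}"
proof -
  have "(\<theta> + 1) * real (Suc n) \<le> 1 * real (Suc n)"
    using assms by (intro mult_right_mono) auto
  then have "nat \<lceil>(\<theta> + 1) * real (Suc n)\<rceil> \<le> Suc n"
    by (simp add: nat_le_iff ceiling_le_iff)
  then show ?thesis by (simp add: cell_index_def)
qed

text \<open>In the rescaled variable \<open>y\<close> the point \<open>grid n k\<close> sits at
  \<open>k - 1\<close>. A cell with \<open>i \<ge> 2\<close> is therefore
  \<open>i - 1 < y \<le> i\<close>, which characterises the ceiling; the first cell is
  \<open>0 \<le> y \<le> 1\<close>.\<close>

lemma in_cell_iff:
  assumes "\<theta> \<in> {-1..0}" "i \<in> {1..Suc n}"
  shows "\<theta> \<in> cell n i \<longleftrightarrow> i = cell_index n \<theta>"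
proof -
  define y where "y = (\<theta> + 1) * real (Suc n)"
  have y: "0 \<le> y" using assms by (simp add: y_def)
  have le: "\<theta> \<le> grid n k \<longleftrightarrow> y \<le> real k - 1" for k
  proof -
    have "\<theta> \<le> grid n k \<longleftrightarrow> \<theta> + 1 \<le> (real k - 1) / real (Suc n)" by (auto simp: grid_def)
    also have "\<dots> \<longleftrightarrow> y \<le> real k - 1" unfolding y_def by (rule pos_le_divide_eq) simp
    finally show ?thesis .
  qed
  have lt: "grid n k < \<theta> \<longleftrightarrow> real k - 1 < y" for k
    using le[of k] by linarith
  have ci: "cell_index n \<theta> = max 1 (nat \<lceil>y\<rceil>)" by (simp add: cell_index_def y_def)
  show ?thesis
  proof (cases "i = 1")
    case True
    have "\<theta> \<in> cell n i \<longleftrightarrow> y \<le> 1" using True le[of 2] assms by (simp add: cell_def)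
    also have "\<dots> \<longleftrightarrow> nat \<lceil>y\<rceil> \<le> 1" by (simp add: nat_le_iff ceiling_le_iff)
    also have "\<dots> \<longleftrightarrow> i = cell_index n \<theta>"
      unfolding ci True by (simp add: max_def del: nat_le_iff nat_ceiling_le_eq) linarith
    finally show ?thesis .
  next
    case False
    then have i: "2 \<le> i" using assms by simp
    have "\<theta> \<in> cell n i \<longleftrightarrow> real i - 1 < y \<and> y \<le> real i"
      using False le[of "i+1"] lt[of i] by (simp add: cell_def)
    also have "\<dots> \<longleftrightarrow> \<lceil>y\<rceil> = int i" by (simp add: ceiling_eq_iff)
    also have "\<dots> \<longleftrightarrow> i = cell_index n \<theta>" using ci i y by auto
    finally show ?thesis .
  qed
qed

text \<open>The left end of a cell is off by at most one mesh width; this drives the pointwise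
  convergence of the step functions below.\<close>

lemma grid_cell_index:
  assumes "\<theta> \<in> {-1..0}"
  shows "\<bar>grid n (cell_index n \<theta>) - \<theta>\<bar> \<le> 1 / real (Suc n)"
proof -
  let ?i = "cell_index n \<theta>"
  have "\<theta> \<in> cell n ?i"
    using in_cell_iff[OF assms cell_index_range[OF assms]] by simp
  then have "grid n ?i \<le> \<theta> \<and> \<theta> \<le> grid n (?i + 1)"
    by (auto simp: cell_def numeral_2_eq_2 split: if_splits)
  moreover have "grid n (?i + 1) = grid n ?i + 1 / real (Suc n)"
    by (simp add: grid_def diff_divide_distrib)
  ultimately show ?thesis by linarith
qed

lemma cell_subset: "i \<in> {1..Suc n} \<Longrightarrow> cell n i \<subseteq> {-1..0}"
  using grid_range[of i n] grid_range[of "i+1" n] grid_range[of 2 n]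
  by (auto simp: cell_def)

section \<open>Convergence of Stieltjes sums\<close>

text \<open>Expresses cell masses through the values \<open>measure M {-1..t}\<close> that
  \<open>represents\<close> controls. For \<open>i = 1\<close> nothing is subtracted, since that
  cell contains -1.\<close>

lemma (in finite_borel_measure) measure_cell:
  assumes "i \<in> {1..Suc n}"
  shows "measure M (cell n i) =
    measure M {-1..grid n (i + 1)} - (if i = 1 then 0 else measure M {-1..grid n i})"
proof (cases "i = 1")
  case True
  then show ?thesis by (simp add: cell_def numeral_2_eq_2)
next
  case False
  have "{-1..grid n (i + 1)} = {-1..grid n i} \<union> cell n i"
    using grid_range[of i n] grid_mono[of i "i+1" n] assms False by (auto simp: cell_def)
  then have "measure M {-1..grid n (i + 1)} = measure M {-1..grid n i} + measure M (cell n i)"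
    using False by (simp, subst finite_measure_Union) (auto simp: cell_def)
  then show ?thesis using False by simp
qed

text \<open>The sums are integrals of step functions sampling \<open>f\<close> at left ends of
  cells. These converge pointwise by continuity, and a constant dominates them because
  \<open>f\<close> is bounded on [-1,0] and the measure is finite.\<close>

lemma (in finite_borel_measure) grid_sums_tendsto:
  fixes f :: "real \<Rightarrow> 'b::{banach,second_countable_topology}"
  assumes f: "continuous_on {-1..0} f"
  shows "(\<lambda>n. \<Sum>i=1..Suc n. measure M (cell n i) *\<^sub>R f (grid n i)) \<longlonglongrightarrow> (LINT \<theta>:{-1..0}|M. f \<theta>)"
proof -
  let ?I = "{-1..0::real}"
  define s where "s n \<theta> = (\<Sum>i=1..Suc n. indicator (cell n i) \<theta> *\<^sub>R f (grid n i))" for n \<theta>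
  have cell_sets: "cell n i \<in> sets borel" for n i by (simp add: cell_def)
  have s_eq: "s n \<theta> = indicator ?I \<theta> *\<^sub>R f (grid n (cell_index n \<theta>))" for n \<theta>
  proof (cases "\<theta> \<in> ?I")
    case True
    \<comment> \<open>Exactly one cell contains \<theta>, so a single summand survives.\<close>
    have "s n \<theta> = (\<Sum>i=1..Suc n. if i = cell_index n \<theta> then f (grid n i) else 0)"
      unfolding s_def by (rule sum.cong) (use in_cell_iff[OF True] in \<open>auto simp: indicator_def\<close>)
    also have "\<dots> = f (grid n (cell_index n \<theta>))"
      using cell_index_range[OF True, of n] by (subst sum.delta) auto
    finally show ?thesis using True by simp
  next
    case False
    then have "s n \<theta> = 0"
      unfolding s_def using cell_subset[of _ n] by (intro sum.neutral) (force simp: indicator_def)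
    then show ?thesis using False by simp
  qed
  obtain B where B: "\<And>x. x \<in> ?I \<Longrightarrow> norm (f x) \<le> B"
    using compact_imp_bounded[OF compact_continuous_image[OF f compact_Icc]]
    unfolding bounded_iff by blast
  have gI: "grid n (cell_index n \<theta>) \<in> ?I" if "\<theta> \<in> ?I" for n \<theta>
    using grid_range cell_index_range[OF that, of n] by auto
  have "(\<lambda>n. integral\<^sup>L M (s n)) \<longlonglongrightarrow> (LINT \<theta>|M. indicator ?I \<theta> *\<^sub>R f \<theta>)"
  proof (rule integral_dominated_convergence[where w = "\<lambda>_. max B 0"])
    show "(\<lambda>\<theta>. indicator ?I \<theta> *\<^sub>R f \<theta>) \<in> borel_measurable M"
      using borel_measurable_continuous_on_indicator[OF _ f]
      by (simp add: measurable_cong_sets[OF M_is_borel refl])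
    show "s n \<in> borel_measurable M" for n
      unfolding s_def
      by (intro borel_measurable_sum borel_measurable_scaleR borel_measurable_indicator
          borel_measurable_const) (simp add: cell_sets M_is_borel)
    show "integrable M (\<lambda>_. max B 0)" by simp
    show "AE \<theta> in M. (\<lambda>n. s n \<theta>) \<longlonglongrightarrow> indicator ?I \<theta> *\<^sub>R f \<theta>"
    proof (rule AE_I2)
      fix \<theta>
      show "(\<lambda>n. s n \<theta>) \<longlonglongrightarrow> indicator ?I \<theta> *\<^sub>R f \<theta>"
      proof (cases "\<theta> \<in> ?I")
        case True
        have "(\<lambda>n. grid n (cell_index n \<theta>) - \<theta>) \<longlonglongrightarrow> 0"
          by (rule Lim_null_comparison[OF always_eventually LIMSEQ_Suc[OF lim_1_over_n]])
            (use grid_cell_index[OF True] in auto)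
        then have "(\<lambda>n. grid n (cell_index n \<theta>)) \<longlonglongrightarrow> \<theta>" by (simp add: LIM_zero_iff)
        then have "(\<lambda>n. f (grid n (cell_index n \<theta>))) \<longlonglongrightarrow> f \<theta>"
          by (rule continuous_on_tendsto_compose[OF f _ True]) (use gI[OF True] in auto)
        then show ?thesis using True by (simp add: s_eq)
      qed (simp add: s_eq)
    qed
    show "AE \<theta> in M. norm (s n \<theta>) \<le> max B 0" for n
      using B gI by (auto simp: s_eq indicator_def le_max_iff_disj)
  qed
  moreover have "integral\<^sup>L M (s n) = (\<Sum>i=1..Suc n. measure M (cell n i) *\<^sub>R f (grid n i))" for n
    unfolding s_def
    by (intro has_bochner_integral_integral_eq has_bochner_integral_sum has_bochner_integral_indicator)
       (simp_all add: cell_sets M_is_borel emeasure_eq_measure)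
  ultimately show ?thesis by (simp add: set_lebesgue_integral_def)
qed

text \<open>The first cell carries the atom at \<open>-1\<close>; because \<open>g (-1) = 0\<close>, its mass is an increment of \<open>g\<close>
  like all the others.\<close>

lemma stieltjes_sums_tendsto:
  fixes f :: "real \<Rightarrow> 'b::{banach,second_countable_topology}"
  assumes rep: "represents g P Q" and g0: "g (-1) = 0" and f: "continuous_on {-1..0} f"
  shows "(\<lambda>n. \<Sum>i=1..Suc n. (g (grid n (i + 1)) - g (grid n i)) *\<^sub>R f (grid n i))
    \<longlonglongrightarrow> stieltjes_integral g f"
proof -
  interpret P: finite_borel_measure P using rep by (simp add: represents_def)
  interpret Q: finite_borel_measure Q using rep by (simp add: represents_def)
  have incr: "g (grid n (i + 1)) - g (grid n i) = measure P (cell n i) - measure Q (cell n i)"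
    if i: "i \<in> {1..Suc n}" for n i
  proof -
    \<comment> \<open>\<open>represents\<close> prescribes nothing at -1, hence the restriction to
      indices from 2 on.\<close>
    have pos: "grid n j \<in> {-1<..0}" if "2 \<le> j" "j \<le> Suc (Suc n)" for j
      using grid_strict_mono[of 1 j n] grid_range[of j n] that by auto
    have g: "g (grid n j) = measure P {-1..grid n j} - measure Q {-1..grid n j}"
      if "2 \<le> j" "j \<le> Suc (Suc n)" for j
      using rep pos[OF that] by (simp add: represents_def)
    show ?thesis
    proof (cases "i = 1")
      case True
      then show ?thesis using g[of 2] g0 P.measure_cell[OF i] Q.measure_cell[OF i]
        by (simp add: numeral_2_eq_2)
    next
      case False
      then show ?thesis using g[of i] g[of "i + 1"] i P.measure_cell[OF i] Q.measure_cell[OF i]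
        by simp
    qed
  qed
  have "(\<Sum>i=1..Suc n. (g (grid n (i + 1)) - g (grid n i)) *\<^sub>R f (grid n i)) =
      (\<Sum>i=1..Suc n. measure P (cell n i) *\<^sub>R f (grid n i))
      - (\<Sum>i=1..Suc n. measure Q (cell n i) *\<^sub>R f (grid n i))" for n
    unfolding sum_subtractf[symmetric]
    by (rule sum.cong[OF refl]) (simp only: incr scaleR_diff_left)
  then show ?thesis
    unfolding stieltjes_integral_eq[OF rep f]
    using tendsto_diff[OF P.grid_sums_tendsto[OF f] Q.grid_sums_tendsto[OF f]] by presburger
qed

section \<open>Estimates by the total variation\<close>

lemma grid_variation_le:
  "ereal (\<Sum>i=1..Suc n. nrm (F (grid n (i + 1)) - F (grid n i))) \<le> variation nrm F"
  unfolding variation_def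
  by (intro Sup_upper CollectI exI[of _ "Suc n"] exI[of _ "grid n"]) (auto intro: grid_strict_mono)

text \<open>On a common grid the two sums differ by a sum weighted with increments of
  \<open>g - h\<close>. Each is at most \<open>C\<close> times the size of an increment of
  \<open>F\<close>, so the total is at most \<open>B * C * V\<close> on every grid, and the bound
  passes to the limit. No total variation measure is involved.\<close>

lemma stieltjes_integral_diff_le:
  fixes f :: "real \<Rightarrow> 'b::{banach,second_countable_topology}"
  assumes g: "represents g P Q" "g (-1) = 0" and h: "represents h P' Q'" "h (-1) = 0"
    and f: "continuous_on {-1..0} f" and B: "\<And>\<theta>. \<theta> \<in> {-1..0} \<Longrightarrow> norm (f \<theta>) \<le> B"
    and var: "variation nrm F \<le> ereal V" and C: "0 \<le> C"
    and incr: "\<And>s t. \<bar>(g t - h t) - (g s - h s)\<bar> \<le> C * nrm (F t - F s)"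
  shows "norm (stieltjes_integral g f - stieltjes_integral h f) \<le> B * C * V"
proof (rule Lim_bounded)
  \<comment> \<open>The sign of \<open>B\<close> is needed when \<open>B * C\<close> multiplies the
    variation bound.\<close>
  have "0 \<le> norm (f 0)" by simp
  also have "norm (f 0) \<le> B" by (rule B) simp
  finally have B0: "0 \<le> B" .
  show "(\<lambda>n. norm ((\<Sum>i=1..Suc n. (g (grid n (i + 1)) - g (grid n i)) *\<^sub>R f (grid n i))
      - (\<Sum>i=1..Suc n. (h (grid n (i + 1)) - h (grid n i)) *\<^sub>R f (grid n i))))
    \<longlonglongrightarrow> norm (stieltjes_integral g f - stieltjes_integral h f)"
    by (intro tendsto_intros stieltjes_sums_tendsto[OF g f] stieltjes_sums_tendsto[OF h f])
  show "\<forall>n\<ge>0. norm ((\<Sum>i=1..Suc n. (g (grid n (i + 1)) - g (grid n i)) *\<^sub>R f (grid n i))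
      - (\<Sum>i=1..Suc n. (h (grid n (i + 1)) - h (grid n i)) *\<^sub>R f (grid n i))) \<le> B * C * V"
  proof (intro allI impI)
    fix n :: nat
    let ?d = "\<lambda>i. (g (grid n (i + 1)) - h (grid n (i + 1))) - (g (grid n i) - h (grid n i))"
    have "norm ((\<Sum>i=1..Suc n. (g (grid n (i + 1)) - g (grid n i)) *\<^sub>R f (grid n i))
        - (\<Sum>i=1..Suc n. (h (grid n (i + 1)) - h (grid n i)) *\<^sub>R f (grid n i)))
      = norm (\<Sum>i=1..Suc n. ?d i *\<^sub>R f (grid n i))"
      unfolding sum_subtractf[symmetric] scaleR_diff_left[symmetric]
      by (intro arg_cong[where f = norm] sum.cong refl arg_cong2[where f = scaleR]) simp
    also have "\<dots> \<le> (\<Sum>i=1..Suc n. C * nrm (F (grid n (i + 1)) - F (grid n i)) * B)"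
    proof (rule sum_norm_le)
      fix i assume "i \<in> {1..Suc n}"
      then have "norm (f (grid n i)) \<le> B" using grid_range[of i n] by (intro B) auto
      then show "norm (?d i *\<^sub>R f (grid n i)) \<le> C * nrm (F (grid n (i + 1)) - F (grid n i)) * B"
        unfolding norm_scaleR using incr[of "grid n (i + 1)" "grid n i"]
        by (intro mult_mono order_trans[OF abs_ge_zero incr]) auto
    qed
    also have "\<dots> = B * C * (\<Sum>i=1..Suc n. nrm (F (grid n (i + 1)) - F (grid n i)))"
      unfolding sum_distrib_left by (intro sum.cong) auto
    also have "\<dots> \<le> B * C * V"
      using order_trans[OF grid_variation_le var] B0 C by (intro mult_left_mono) auto
    finally show "norm ((\<Sum>i=1..Suc n. (g (grid n (i + 1)) - g (grid n i)) *\<^sub>R f (grid n i))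
        - (\<Sum>i=1..Suc n. (h (grid n (i + 1)) - h (grid n i)) *\<^sub>R f (grid n i))) \<le> B * C * V" .
  qed
qed

text \<open>With the zero function represented, bounding a single integral becomes the case
  \<open>h = 0\<close> of the difference estimate.\<close>

lemma represents_zero: "represents g P Q \<Longrightarrow> represents (\<lambda>_. 0) P P"
  by (simp add: represents_def)

lemma stieltjes_integral_zero:
  fixes f :: "real \<Rightarrow> 'b::{banach,second_countable_topology}"
  assumes "represents (\<lambda>_. 0) P P" and "continuous_on {-1..0} f"
  shows "stieltjes_integral (\<lambda>_. 0) f = 0"
  using stieltjes_integral_eq[OF assms] by simp

text \<open>The modulus is \<open>exp (Re s * \<theta>)\<close>. As \<theta> is nonpositive,
  \<open>Re s\<close> may be lowered to \<alpha>, and as \<alpha> is nonpositive, the worst point is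
  \<theta> = -1.\<close>

lemma norm_exp_half_plane_le:
  assumes "\<alpha> \<le> Re s" "\<alpha> \<le> 0" "\<theta> \<in> {-1..0}"
  shows "norm (exp (s * complex_of_real \<theta>)) \<le> exp (- \<alpha>)"
proof -
  have "Re s * \<theta> \<le> \<alpha> * \<theta>" using assms by (intro mult_right_mono_neg) auto
  also have "\<dots> \<le> \<alpha> * (-1)" using assms by (intro mult_left_mono_neg) auto
  finally show ?thesis by simp
qed

text \<open>Two instances of the difference estimate: against 0 with \<open>F = M\<close> for the
  bound, against \<open>M'\<close> with \<open>F = M - M'\<close> for the Lipschitz estimate. One
  \<open>K\<close> serves for both and does not depend on \<open>s\<close> or
  \<open>M'\<close>.\<close>

lemma integral_exp_bounds:
  fixes N :: "real ^ 'n \<Rightarrow> real" and M :: "real \<Rightarrow> real ^ 'n ^ 'n"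
  assumes N: "is_norm N" and M: "M \<in> NBV N" and \<alpha>: "\<alpha> \<le> 0"
  obtains K where "0 \<le> K"
    "\<And>s i j. \<alpha> \<le> Re s \<Longrightarrow> norm (integral_exp M s $ i $ j) \<le> K"
    "\<And>M' s i j V. M' \<in> NBV N \<Longrightarrow> Var N (\<lambda>\<theta>. M \<theta> - M' \<theta>) \<le> ereal V \<Longrightarrow> \<alpha> \<le> Re s \<Longrightarrow>
      norm (integral_exp M s $ i $ j - integral_exp M' s $ i $ j) \<le> K * V"
proof -
  obtain C where C: "0 \<le> C" "\<And>A i j. \<bar>A $ i $ j\<bar> \<le> C * matrix_norm N A" "\<And>A. 0 \<le> matrix_norm N A"
    using matrix_norm_entry_bound[OF N] by metis
  define E where "E = exp (- \<alpha>)"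
  have E: "0 < E" by (simp add: E_def)
  have cont: "continuous_on {-1..0} (\<lambda>\<theta>. exp (s * complex_of_real \<theta>))" for s
    by (intro continuous_intros)
  have bnd: "norm (exp (s * complex_of_real \<theta>)) \<le> E" if "\<alpha> \<le> Re s" "\<theta> \<in> {-1..0}" for s \<theta>
    unfolding E_def using norm_exp_half_plane_le[OF that(1) \<alpha> that(2)] .
  \<comment> \<open>The partition with one cell shows that the variation is nonnegative, so it is a
    real number \<open>V0\<close> and not -\<infinity>.\<close>
  have "0 \<le> (\<Sum>i=1..Suc 0. matrix_norm N (M (grid 0 (i + 1)) - M (grid 0 i)))"
    using C(3) by (intro sum_nonneg) auto
  then have "0 \<le> Var N M" using grid_variation_le[of "matrix_norm N" M 0]
    by (meson ereal_less_eq(5) order_trans)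
  moreover have "Var N M < \<infinity>" using M by (simp add: NBV_def)
  ultimately obtain V0 where V0: "Var N M = ereal V0" "0 \<le> V0" by (cases "Var N M") auto
  have zero: "M' (-1) $ i $ j = 0" if "M' \<in> NBV N" for M' i j
    using that by (simp add: NBV_def)
  show ?thesis
  \<comment> \<open>\<open>E\<close> bounds the exponential, \<open>C\<close> compares entries with
    \<open>matrix_norm\<close>, and \<open>V0\<close> is the variation of \<open>M\<close>. The
    maximum with 1 makes the same product dominate the Lipschitz constant
    \<open>E * C\<close>.\<close>
  proof (rule that[of "E * C * max V0 1"])
    show "0 \<le> E * C * max V0 1" using E C(1) by simp
    show "norm (integral_exp M s $ i $ j) \<le> E * C * max V0 1" if s: "\<alpha> \<le> Re s" for s i j
    proof -
      obtain P Q where rep: "represents (\<lambda>\<theta>. M \<theta> $ i $ j) P Q"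
        using NBV_entry_represents[OF N M] by blast
      note rep0 = represents_zero[OF rep]
      have "norm (stieltjes_integral (\<lambda>\<theta>. M \<theta> $ i $ j) (\<lambda>\<theta>. exp (s * complex_of_real \<theta>))
          - stieltjes_integral (\<lambda>_. 0) (\<lambda>\<theta>. exp (s * complex_of_real \<theta>))) \<le> E * C * V0"
        using C(2)[of "M _ - M _" i j]
        by (intro stieltjes_integral_diff_le[OF rep zero[OF M] rep0 refl cont bnd[OF s] _ C(1),
              where nrm = "matrix_norm N" and F = M]) (auto simp: V0)
      also have "\<dots> \<le> E * C * max V0 1" using E C(1) by (intro mult_left_mono) auto
      finally show ?thesis by (simp add: integral_exp_def stieltjes_integral_zero[OF rep0 cont])
    qed
    show "norm (integral_exp M s $ i $ j - integral_exp M' s $ i $ j) \<le> E * C * max V0 1 * V"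
      if M': "M' \<in> NBV N" and V: "Var N (\<lambda>\<theta>. M \<theta> - M' \<theta>) \<le> ereal V" and s: "\<alpha> \<le> Re s"
      for M' s i j V
    proof -
      obtain P Q where rep: "represents (\<lambda>\<theta>. M \<theta> $ i $ j) P Q"
        using NBV_entry_represents[OF N M] by blast
      obtain P' Q' where rep': "represents (\<lambda>\<theta>. M' \<theta> $ i $ j) P' Q'"
        using NBV_entry_represents[OF N M'] by blast
      have "0 \<le> (\<Sum>i=1..Suc 0. matrix_norm N ((M (grid 0 (i + 1)) - M' (grid 0 (i + 1))) - (M (grid 0 i) - M' (grid 0 i))))"
        using C(3) by (intro sum_nonneg) auto
      then have "0 \<le> ereal V" 
        using order_trans[OF grid_variation_le[of "matrix_norm N" "\<lambda>\<theta>. M \<theta> - M' \<theta>" 0] V]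
        by (metis (no_types, lifting) ereal_less_eq(3) ereal_less_eq(5) order_trans)
      then have V0': "0 \<le> V" by simp
      have "norm (stieltjes_integral (\<lambda>\<theta>. M \<theta> $ i $ j) (\<lambda>\<theta>. exp (s * complex_of_real \<theta>))
          - stieltjes_integral (\<lambda>\<theta>. M' \<theta> $ i $ j) (\<lambda>\<theta>. exp (s * complex_of_real \<theta>))) \<le> E * C * V"
      proof (rule stieltjes_integral_diff_le[OF rep zero[OF M] rep' zero[OF M'] cont bnd[OF s] V C(1)])
        fix t u
        show "\<bar>(M t $ i $ j - M' t $ i $ j) - (M u $ i $ j - M' u $ i $ j)\<bar>
            \<le> C * matrix_norm N ((M t - M' t) - (M u - M' u))"
          using C(2)[of "(M t - M' t) - (M u - M' u)" i j] by simp
      qed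
      also have "\<dots> \<le> E * C * max V0 1 * V"
        using E C(1) V0' mult_left_mono[of 1 "max V0 1" "E * C"] by (intro mult_right_mono) auto
      finally show ?thesis by (simp add: integral_exp_def)
    qed
  qed
qed

section \<open>Determinants under small changes of the entries\<close>

lemma norm_matrix_le_of_entries:
  fixes A :: "'a::real_normed_vector ^ 'n ^ 'm"
  assumes "\<And>i j. norm (A $ i $ j) \<le> b"
  shows "norm A \<le> real CARD('m) * (real CARD('n) * b)"
proof -
  have row: "norm (A $ i) \<le> real CARD('n) * b" for i
  proof -
    have "norm (A $ i) \<le> (\<Sum>j\<in>UNIV. norm (A $ i $ j))"
      unfolding norm_vec_def[of "A $ i"] by (rule L2_set_le_sum) simp
    also have "\<dots> \<le> real CARD('n) * b" using sum_bounded_above[of UNIV "\<lambda>j. norm (A $ i $ j)" b] assms by simp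
    finally show ?thesis .
  qed
  have "norm A \<le> (\<Sum>i\<in>UNIV. norm (A $ i))"
    unfolding norm_vec_def[of A] by (rule L2_set_le_sum) simp
  also have "\<dots> \<le> real CARD('m) * (real CARD('n) * b)"
    using sum_bounded_above[of UNIV "\<lambda>i. norm (A $ i)" "real CARD('n) * b"] row by simp
  finally show ?thesis .
qed

text \<open>The determinant is polynomial in the entries, hence uniformly continuous on a compact
  ball. That \<eta> works for all \<open>A\<close> at once later gives uniformity in
  \<open>s\<close>.\<close>

lemma det_uniformly_continuous_entries:
  fixes K \<delta> :: real
  assumes \<delta>: "0 < \<delta>"
  obtains \<eta> where "0 < \<eta>"
    "\<And>A A' :: complex ^ 'n ^ 'n. (\<And>i j. norm (A $ i $ j) \<le> K) \<Longrightarrow>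
       (\<And>i j. norm (A $ i $ j - A' $ i $ j) \<le> \<eta>) \<Longrightarrow> norm (det A - det A') < \<delta>"
proof -
  define c where "c = real CARD('n) * real CARD('n)"
  have c: "0 < c" by (simp add: c_def)
  have le: "norm A \<le> c * b" if "\<And>i j. norm (A $ i $ j) \<le> b" for A :: "complex ^ 'n ^ 'n" and b
    using norm_matrix_le_of_entries[of A b] that by (simp add: c_def mult.assoc)
  \<comment> \<open>The matrix \<open>A\<close> has norm at most \<open>c * K\<close>; the extra 1
    leaves room for \<open>A'\<close>.\<close>
  let ?S = "cball (0 :: complex ^ 'n ^ 'n) (c * K + 1)"
  have "continuous_on ?S det" unfolding det_def by (intro continuous_intros)
  then have "uniformly_continuous_on ?S det"
    by (rule compact_uniformly_continuous) simp
  then obtain d where d: "0 < d"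
    "\<And>A A'. A \<in> ?S \<Longrightarrow> A' \<in> ?S \<Longrightarrow> dist A' A < d \<Longrightarrow> dist (det A') (det A) < \<delta>"
    unfolding uniformly_continuous_on_def using \<delta> by metis
  \<comment> \<open>Dividing by \<open>c\<close> turns the entrywise bound into one on the norm: 1
    keeps \<open>A'\<close> in the ball, and \<open>d / 2\<close> gives a distance strictly below
    \<open>d\<close>.\<close>
  define \<eta> where "\<eta> = min 1 (d / 2) / c"
  show ?thesis
  proof (rule that[of \<eta>])
    show "0 < \<eta>" using c d by (simp add: \<eta>_def)
    fix A A' :: "complex ^ 'n ^ 'n"
    assume A: "\<And>i j. norm (A $ i $ j) \<le> K" and A': "\<And>i j. norm (A $ i $ j - A' $ i $ j) \<le> \<eta>"
    have "norm (A - A') \<le> c * \<eta>" using A' by (intro le) simp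
    then have dist: "norm (A - A') \<le> min 1 (d / 2)" using c by (simp add: \<eta>_def)
    have nA: "norm A \<le> c * K" using A by (rule le)
    have "norm A' \<le> norm A + norm (A - A')"
      using norm_triangle_ineq4[of A "A - A'"] by simp
    then have "A \<in> ?S" "A' \<in> ?S" using nA dist by auto
    then have "dist (det A) (det A') < \<delta>" using dist d(1) by (intro d(2)) (auto simp: dist_norm)
    then show "norm (det A - det A') < \<delta>" by (simp add: dist_norm)
  qed
qed

section \<open>Perturbation of the characteristic function and stability\<close>

lemma char_fun_perturbation:
  fixes N :: "real ^ 'n \<Rightarrow> real" and M :: "real \<Rightarrow> real ^ 'n ^ 'n"
  assumes N: "is_norm N" and M: "M \<in> NBV N" and \<alpha>: "\<alpha> \<le> 0" and \<delta>: "0 < \<delta>"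
  obtains \<epsilon> where "0 < \<epsilon>"
    "\<And>M' s. M' \<in> NBV N \<Longrightarrow> Var N (\<lambda>\<theta>. M \<theta> - M' \<theta>) < ereal \<epsilon> \<Longrightarrow> \<alpha> \<le> Re s \<Longrightarrow>
      cmod (char_fun M s - char_fun M' s) < \<delta>"
proof -
  obtain K where K: "0 \<le> K"
    "\<And>s i j. \<alpha> \<le> Re s \<Longrightarrow> norm (integral_exp M s $ i $ j) \<le> K"
    "\<And>M' s i j V. M' \<in> NBV N \<Longrightarrow> Var N (\<lambda>\<theta>. M \<theta> - M' \<theta>) \<le> ereal V \<Longrightarrow> \<alpha> \<le> Re s \<Longrightarrow>
      norm (integral_exp M s $ i $ j - integral_exp M' s $ i $ j) \<le> K * V"
    by (rule integral_exp_bounds[OF N M \<alpha>]) (blast intro: that)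
  obtain \<eta> where \<eta>: "0 < \<eta>"
    "\<And>A A' :: complex ^ 'n ^ 'n. (\<And>i j. norm (A $ i $ j) \<le> 1 + K) \<Longrightarrow>
       (\<And>i j. norm (A $ i $ j - A' $ i $ j) \<le> \<eta>) \<Longrightarrow> norm (det A - det A') < \<delta>"
    by (rule det_uniformly_continuous_entries[OF \<delta>, of "1 + K"]) (blast intro: that)
  \<comment> \<open>Chosen so that \<open>K * \<epsilon> \<le> \<eta>\<close>; the 1 avoids division
    by zero when \<open>K = 0\<close>.\<close>
  define \<epsilon> where "\<epsilon> = \<eta> / (K + 1)"
  show ?thesis
  proof (rule that[of \<epsilon>])
    show "0 < \<epsilon>" using \<eta> K by (simp add: \<epsilon>_def)
    fix M' s assume M': "M' \<in> NBV N" "Var N (\<lambda>\<theta>. M \<theta> - M' \<theta>) < ereal \<epsilon>" and s: "\<alpha> \<le> Re s"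
    have K\<epsilon>: "K * \<epsilon> \<le> \<eta>" using \<eta> K by (simp add: \<epsilon>_def field_simps)
    show "cmod (char_fun M s - char_fun M' s) < \<delta>"
      unfolding char_fun_def
    proof (rule \<eta>(2))
      fix i j
      have "norm ((mat 1 :: complex ^ 'n ^ 'n) $ i $ j) \<le> 1" by (simp add: mat_def)
      then show "norm ((mat 1 - integral_exp M s) $ i $ j) \<le> 1 + K"
        using norm_triangle_ineq4[of "(mat 1 :: complex ^ 'n ^ 'n) $ i $ j" "integral_exp M s $ i $ j"]
          K(2)[OF s, of i j] by simp
      show "norm ((mat 1 - integral_exp M s) $ i $ j - (mat 1 - integral_exp M' s) $ i $ j) \<le> \<eta>"
        using K(3)[OF M'(1) less_imp_le[OF M'(2)] s, of i j] K\<epsilon> by (simp add: norm_minus_commute)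
    qed
  qed
qed

theorem corollary3p3:
  fixes N :: "real ^ 'n \<Rightarrow> real" and M :: "real \<Rightarrow> real ^ 'n ^ 'n"
  assumes "is_norm N"
    and "M \<in> L N \<inter> G N"
    and "exponentially_stable N M"
  shows "\<exists>\<epsilon>>0::real. \<forall>M' \<in> L N \<inter> G N.
           Var N (\<lambda>\<theta>. M \<theta> - M' \<theta>) < ereal \<epsilon> \<longrightarrow> exponentially_stable N M'"
proof -
  have "spectral_abscissa M < 0"
    using assms(2,3) by (simp add: G_def exponentially_stable_def)
  \<comment> \<open>Lying above the abscissa, \<alpha> makes the infimum in \<open>L\<close>
    positive; lying below 0, it leaves a margin for the perturbed abscissa.\<close>
  then obtain \<alpha> where \<alpha>: "spectral_abscissa M < ereal \<alpha>" "ereal \<alpha> < 0"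
    using ereal_dense2 by blast
  define \<delta> where "\<delta> = (INF s\<in>{s. \<alpha> \<le> Re s}. cmod (char_fun M s))"
  have \<delta>: "0 < \<delta>" using assms(2) \<alpha>(1) by (simp add: L_def \<delta>_def)
  have \<delta>_le: "\<delta> \<le> cmod (char_fun M s)" if "\<alpha> \<le> Re s" for s
    unfolding \<delta>_def using that by (intro cINF_lower bdd_belowI2[of _ 0]) auto
  have M: "M \<in> NBV N" using assms(2) by (simp add: L_def)
  have "\<alpha> \<le> 0" using \<alpha>(2) by simp
  obtain \<epsilon> where \<epsilon>: "0 < \<epsilon>"
    "\<And>M' s. M' \<in> NBV N \<Longrightarrow> Var N (\<lambda>\<theta>. M \<theta> - M' \<theta>) < ereal \<epsilon> \<Longrightarrow> \<alpha> \<le> Re s \<Longrightarrow>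
      cmod (char_fun M s - char_fun M' s) < \<delta>"
    by (rule char_fun_perturbation[OF assms(1) M \<open>\<alpha> \<le> 0\<close> \<delta>]) (blast intro: that)
  have "exponentially_stable N M'"
    if M': "M' \<in> L N \<inter> G N" and V: "Var N (\<lambda>\<theta>. M \<theta> - M' \<theta>) < ereal \<epsilon>" for M'
  proof -
    have "M' \<in> NBV N" using M' by (simp add: L_def)
    \<comment> \<open>At a zero of \<open>char_fun M'\<close> with \<open>Re s > \<alpha>\<close>,
      closeness would force \<open>cmod (char_fun M s) < \<delta>\<close>, against the choice of
      \<delta> as infimum.\<close>
    then have "Re s \<le> \<alpha>" if "char_fun M' s = 0" for s
      using \<epsilon>(2)[OF _ V, of s] \<delta>_le[of s] that by force
    \<comment> \<open>This includes the case without zeros, where the supremum is -\<infinity>.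
      Membership of \<open>M'\<close> in \<open>G\<close> then turns the negative abscissa into a
      negative exponential rate.\<close>
    then have "spectral_abscissa M' \<le> ereal \<alpha>"
      unfolding spectral_abscissa_def by (intro Sup_least) auto
    then have "spectral_abscissa M' < 0" using \<alpha>(2) by (rule order_le_less_trans)
    then show ?thesis using M' by (simp add: G_def exponentially_stable_def)
  qed
  then show ?thesis using \<epsilon>(1) by blast
qed

end
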